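(* Let $\delta\in(0,1)$. Let $F:\mathbb{R}^d\to\mathbb{R}$ be lower bounded by $F^*$ with $\Delta_1\ge F(x_1)-F^*$, and $L$-smooth. Let $(x_t)$ be generated by NSGD with stepsizes $\eta_t>0$ and (random) gradient estimators $g_t$, set $\mathcal{F}_{t-1}:=\sigma(g_1,\dots,g_{t-1})$, and assume $$\sigma_t:=\mathbb{E}\big[\|g_t-\nabla F(x_t)\|\,\big|\,\mathcal{F}_{t-1}\big]<\infty .$$ Let $T\ge1$, $\eta_T^{\max}:=\max_{1\le t\le T}\eta_t$ and $C_T:=\max_{1\le t\le T}\eta_t\sum_{\tau=1}^{t-1}\eta_\tau$. Then, with probability at least $1-\delta$, $$\sum_{t=1}^T\frac{\eta_t}{\sum_{\tau=1}^T\eta_\tau}\|\nabla F(x_t)\|\le\frac{2\Delta_1+L\sum_{t=1}^T\eta_t^2+4\sum_{t=1}^T\eta_t\sigma_t}{\sum_{\tau=1}^T\eta_\tau}+\frac{12\big(\eta_T^{\max}\|\nabla F(x_1)\|+C_TL\big)\log(1/\delta)}{\sum_{\tau=1}^T\eta_\tau}.$$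
   Context: (Lower boundedness) $F\ge F^*>-\infty$ on $\mathbb{R}^d$, and $\Delta_1\ge F(x_1)-F^*$ is a given upper bound on the initialization gap. ($L$-smoothness) $F$ is differentiable and $\|\nabla F(x)-\nabla F(y)\|\le L\|x-y\|$ for all $x,y\in\mathbb{R}^d$, where $L\ge 0$. NSGD: from a deterministic initial point $x_1$, iterate $x_{t+1}=x_t-\eta_t\,g_t/\|g_t\|$, where $\eta_t>0$ are predefined deterministic stepsizes and $g_t$ is any random vector in $\mathbb{R}^d$ (the gradient estimator; no unbiasedness is assumed). Convention: $g/\|g\|:=0$ if $g=0$. $\mathcal{F}_0$ is the trivial $\sigma$-algebra; empty sums are $0$. *)

theory Defs
  imports "HOL-Probability.Probability"
begin

definition gradient :: "('v::euclidean_space \<Rightarrow> real) \<Rightarrow> 'v \<Rightarrow> 'v" where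
  "gradient F x = (THE D. GDERIV F x :> D)"

lemma gderiv_gradient:
  fixes F :: "'v::euclidean_space \<Rightarrow> real"
  assumes "F differentiable (at x)"
  shows "GDERIV F x :> gradient F x"
proof -
  obtain f' where f': "(F has_derivative f') (at x)"
    using assms by (auto simp: differentiable_def)
  interpret bounded_linear f'
    using f' by (rule has_derivative_bounded_linear)
  define D where "D = (\<Sum>b\<in>Basis. f' b *\<^sub>R b)"
  have "f' h = inner h D" for h
  proof -
    have "f' h = f' (\<Sum>b\<in>Basis. inner h b *\<^sub>R b)"
      by (simp add: euclidean_representation)
    also have "\<dots> = (\<Sum>b\<in>Basis. inner h b * f' b)"
      by (simp add: sum scaleR)
    also have "\<dots> = inner h D"
      by (simp add: D_def inner_sum_right mult.commute)
    finally show ?thesis .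
  qed
  then have "f' = (\<lambda>h. inner h D)" by blast
  with f' have D: "GDERIV F x :> D"
    by (simp add: gderiv_def)
  have "E = D" if "GDERIV F x :> E" for E
  proof -
    have "(\<lambda>h. inner h E) = (\<lambda>h. inner h D)"
      using has_derivative_unique that D unfolding gderiv_def by blast
    then show ?thesis
      by (metis vector_eq_ldot)
  qed
  with D show ?thesis
    unfolding gradient_def by (metis theI)
qed

definition L_smooth :: "real \<Rightarrow> ('v::euclidean_space \<Rightarrow> real) \<Rightarrow> bool" where
  "L_smooth L F \<longleftrightarrow> L \<ge> 0 \<and> (\<forall>x. F differentiable (at x)) \<and>
     (\<forall>x y. norm (gradient F x - gradient F y) \<le> L * norm (x - y))"

text \<open>
  Indices start at 1; the values \<open>x 0\<close>, \<open>g 0\<close>, \<open>\<eta> 0\<close> play no role.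
  Since \<open>inverse 0 = 0\<close>, the normalized direction is 0 wherever \<open>g t \<omega> = 0\<close>.
\<close>

definition nsgd ::
  "'a measure \<Rightarrow> 'v::euclidean_space \<Rightarrow> (nat \<Rightarrow> real) \<Rightarrow> (nat \<Rightarrow> 'a \<Rightarrow> 'v) \<Rightarrow> (nat \<Rightarrow> 'a \<Rightarrow> 'v) \<Rightarrow> bool"
  where
  "nsgd M x1 \<eta> g x \<longleftrightarrow>
     (\<forall>\<omega>\<in>space M. x 1 \<omega> = x1 \<and>
        (\<forall>t\<ge>1. x (Suc t) \<omega> = x t \<omega> - \<eta> t *\<^sub>R (g t \<omega> /\<^sub>R norm (g t \<omega>))))"

text \<open>
  The \<open>\<sigma>\<close>-algebra generated by \<open>g 1, \<dots>, g n\<close>, as a measure space on \<open>space M\<close> of which only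
  the measurable sets matter; it is trivial for \<open>n = 0\<close>.
\<close>

definition hist :: "'a measure \<Rightarrow> (nat \<Rightarrow> 'a \<Rightarrow> 'v::euclidean_space) \<Rightarrow> nat \<Rightarrow> 'a measure" where
  "hist M g n = sigma (space M) {g s -` B \<inter> space M | s B. s \<in> {1..n} \<and> B \<in> sets borel}"

text \<open>
  The conditional expectation of the error norm is the \<open>[0,\<infinity>]\<close>-valued one,
  so that no integrability of the error is needed.
\<close>

definition cond_error ::
  "'a measure \<Rightarrow> ('v::euclidean_space \<Rightarrow> real) \<Rightarrow> (nat \<Rightarrow> 'a \<Rightarrow> 'v) \<Rightarrow> (nat \<Rightarrow> 'a \<Rightarrow> 'v) \<Rightarrow> nat \<Rightarrow> 'a \<Rightarrow> ennreal"
  where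
  "cond_error M F g x t =
     nn_cond_exp M (hist M g (t - 1)) (\<lambda>\<omega>. ennreal (norm (g t \<omega> - gradient F (x t \<omega>))))"

end

theory Submission
  imports Defs
begin

text \<open>
  Write \<open>G\<^sub>t\<close> for the gradient at \<open>x\<^sub>t\<close>, \<open>u\<^sub>t\<close> for the normalized estimator, \<open>a\<^sub>t = \<eta>\<^sub>t \<parallel>G\<^sub>t\<parallel>\<close>,
  \<open>e\<^sub>t = \<parallel>g\<^sub>t - G\<^sub>t\<parallel>\<close> and \<open>Z\<^sub>t = \<eta>\<^sub>t \<langle>G\<^sub>t, u\<^sub>t\<rangle>\<close>. The descent lemma bounds \<open>\<Sum> Z\<^sub>t\<close>, and
  \<open>Z\<^sub>t \<ge> a\<^sub>t - 2 \<eta>\<^sub>t e\<^sub>t\<close>. Since every step has length at most \<open>\<eta>\<^sub>t\<close>, smoothness gives the deterministic bound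
  \<open>a\<^sub>t \<le> K\<close> with \<open>K = \<eta>max \<parallel>G\<^sub>1\<parallel> + C L\<close>. For \<open>\<theta> = 1 / (2 K)\<close>,
  \<open>exp (- \<theta> Z\<^sub>t) \<le> 1 - \<theta> Z\<^sub>t + (\<theta> a\<^sub>t)\<^sup>2 \<le> 1 - \<theta> a\<^sub>t / 2 + 2 \<theta> \<eta>\<^sub>t e\<^sub>t\<close>, so conditioning on the past shows that
  \<open>exp (\<theta> \<Sum> (a\<^sub>t / 2 - 2 \<eta>\<^sub>t \<sigma>\<^sub>t - Z\<^sub>t))\<close> is a supermartingale, and the Chernoff bound concludes.
  This yields the factor 4 in place of 12.
\<close>

section \<open>Two elementary inequalities\<close>

text \<open>For \<open>z > 0\<close> this follows from \<open>exp z \<ge> 1 + z\<close> and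
  \<open>(1 - z + z^2) * (1 + z) = 1 + z^3 \<ge> 1\<close>. The separate bound \<open>b\<close> lets
  the quadratic term be known from the past even when \<open>z\<close> itself depends on the current
  estimator.\<close>

lemma exp_minus_le_quadratic:
  fixes z b :: real
  assumes "\<bar>z\<bar> \<le> b" "b \<le> 1"
  shows "exp (- z) \<le> 1 - z + b\<^sup>2"
proof -
  have "exp (- z) \<le> 1 - z + z\<^sup>2"
  proof (cases "z \<le> 0")
    case True
    then show ?thesis
      using exp_bound[of "- z"] assms by simp
  next
    case False
    then have z: "0 < z" by simp
    have "1 \<le> (1 - z + z\<^sup>2) * (1 + z)"
      using z by (simp add: algebra_simps power2_eq_square)
    also have "\<dots> \<le> (1 - z + z\<^sup>2) * exp z"
      using z assms by (intro mult_left_mono) auto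
    finally show ?thesis
      by (simp add: exp_minus field_simps)
  qed
  also have "z\<^sup>2 \<le> b\<^sup>2"
    using assms by (metis abs_ge_zero power2_abs power_mono)
  finally show ?thesis by simp
qed

text \<open>With \<open>u\<close> the direction of \<open>w\<close>, the inner product of
  \<open>v\<close> and \<open>u\<close> equals \<open>norm w - inner (w - v) u\<close>, which is at
  least \<open>norm w - norm (w - v)\<close>; the triangle inequality costs the second
  \<open>norm (w - v)\<close>. For \<open>w = 0\<close> the right side is 0 and the left side is
  \<open>- norm v\<close>.\<close>

lemma inner_normalized_ge:
  fixes v w :: "'v::real_inner"
  shows "norm v - 2 * norm (w - v) \<le> inner v (w /\<^sub>R norm w)"
proof (cases "w = 0")
  case False
  define u where "u = w /\<^sub>R norm w"
  have u: "norm u = 1" "inner w u = norm w"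
    using False by (simp_all add: u_def dot_square_norm power2_eq_square)
  have "inner (w - v) u \<le> norm (w - v)"
    using norm_cauchy_schwarz[of "w - v" u] u by simp
  moreover have "norm v \<le> norm w + norm (w - v)"
    by (metis norm_minus_commute norm_triangle_sub)
  ultimately show ?thesis
    using u by (simp add: inner_diff_left flip: u_def)
qed auto

subsection \<open>Smooth functions\<close>

text \<open>On the segment from \<open>x\<close> to \<open>y\<close>, \<open>h\<close> is
  \<open>F\<close> minus the linear and quadratic terms of the bound. The Lipschitz gradient makes
  its derivative nonpositive, so \<open>h 1 \<le> h 0\<close>, which is the claim.\<close>

lemma L_smooth_descent:
  fixes F :: "'v::euclidean_space \<Rightarrow> real"
  assumes "L_smooth L F"
  shows "F y \<le> F x + inner (gradient F x) (y - x) + L / 2 * (norm (y - x))\<^sup>2"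
proof -
  define d where "d = y - x"
  define h where "h s = F (x + s *\<^sub>R d) - s * inner (gradient F x) d - L / 2 * s\<^sup>2 * (norm d)\<^sup>2"
    for s :: real
  have "h 0 \<ge> h 1"
  proof (rule DERIV_nonpos_imp_nonincreasing[where f = h])
    fix s :: real assume s: "0 \<le> s" "s \<le> 1"
    define z where "z = x + s *\<^sub>R d"
    have "F differentiable (at z)"
      using assms by (simp add: L_smooth_def)
    then have F': "(F has_derivative (\<lambda>k. inner k (gradient F z))) (at (x + s *\<^sub>R d))"
      unfolding z_def
      using gderiv_gradient gderiv_def by blast
    have "((\<lambda>s. x + s *\<^sub>R d) has_derivative (\<lambda>k. k *\<^sub>R d)) (at s)"
      by (auto intro!: derivative_eq_intros)
    from has_derivative_compose[OF this F']
    have "((\<lambda>s. F (x + s *\<^sub>R d)) has_derivative (\<lambda>k. inner (k *\<^sub>R d) (gradient F z))) (at s)" .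
    moreover have "(\<lambda>k. inner (k *\<^sub>R d) (gradient F z)) = (*) (inner (gradient F z) d)"
      by (simp add: fun_eq_iff inner_commute)
    ultimately have "((\<lambda>s. F (x + s *\<^sub>R d)) has_real_derivative inner (gradient F z) d) (at s)"
      by (simp add: has_field_derivative_def)
    then have "(h has_real_derivative
        inner (gradient F z) d - inner (gradient F x) d - L * s * (norm d)\<^sup>2) (at s)"
      unfolding h_def by (auto intro!: derivative_eq_intros)
    moreover have "inner (gradient F z) d - inner (gradient F x) d \<le> L * s * (norm d)\<^sup>2"
    proof -
      have "inner (gradient F z) d - inner (gradient F x) d
          \<le> norm (gradient F z - gradient F x) * norm d"
        by (metis inner_diff_left norm_cauchy_schwarz)
      also have "\<dots> \<le> (L * norm (z - x)) * norm d"
        using assms by (intro mult_right_mono) (auto simp: L_smooth_def)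
      also have "\<dots> = L * s * (norm d)\<^sup>2"
        using s by (simp add: z_def power2_eq_square)
      finally show ?thesis .
    qed
    ultimately show "\<exists>y. (h has_real_derivative y) (at s) \<and> y \<le> 0"
      by (intro exI conjI) auto
  qed simp
  then show ?thesis
    by (simp add: h_def d_def)
qed

text \<open>Continuity makes the gradient a Borel map, so that gradients at measurable iterates are
  measurable.\<close>

lemma L_smooth_continuous_gradient:
  fixes F :: "'v::euclidean_space \<Rightarrow> real"
  assumes "L_smooth L F"
  shows "continuous_on UNIV (gradient F)"
proof (rule lipschitz_on_continuous_on)
  show "L-lipschitz_on UNIV (gradient F)"
    using assms by (intro lipschitz_onI) (auto simp: L_smooth_def dist_norm)
qed

subsection \<open>A conditional exponential inequality\<close>

context sigma_finite_subalgebra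
begin

text \<open>
  The exponential is bounded by a quadratic before conditioning, so that only the first moment of
  the unbounded error \<open>e\<close> enters.
\<close>

lemma nn_integral_exp_step:
  fixes Y a Z e \<sigma> :: "'a \<Rightarrow> real" and c \<theta> :: real
  assumes [measurable]: "Y \<in> borel_measurable F" "a \<in> borel_measurable F"
      "Z \<in> borel_measurable M" "e \<in> borel_measurable M"
    and c: "0 \<le> c" and \<theta>: "0 \<le> \<theta>"
    and Y: "\<And>\<omega>. \<omega> \<in> space M \<Longrightarrow> 0 \<le> Y \<omega>"
    and e: "\<And>\<omega>. \<omega> \<in> space M \<Longrightarrow> 0 \<le> e \<omega>"
    and a: "\<And>\<omega>. \<omega> \<in> space M \<Longrightarrow> \<theta> * a \<omega> \<le> 1 / 2"
    and Za: "\<And>\<omega>. \<omega> \<in> space M \<Longrightarrow> \<bar>Z \<omega>\<bar> \<le> a \<omega>"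
    and Ze: "\<And>\<omega>. \<omega> \<in> space M \<Longrightarrow> a \<omega> - c * e \<omega> \<le> Z \<omega>"
    and fin: "AE \<omega> in M. nn_cond_exp M F (\<lambda>\<omega>. ennreal (e \<omega>)) \<omega> < \<infinity>"
    and \<sigma>: "\<sigma> = (\<lambda>\<omega>. enn2real (nn_cond_exp M F (\<lambda>\<omega>. ennreal (e \<omega>)) \<omega>))"
  shows "(\<integral>\<^sup>+\<omega>. ennreal (Y \<omega> * exp (\<theta> * (a \<omega> / 2 - c * \<sigma> \<omega> - Z \<omega>))) \<partial>M)
      \<le> (\<integral>\<^sup>+\<omega>. ennreal (Y \<omega>) \<partial>M)"
proof -
  define E where "E = nn_cond_exp M F (\<lambda>\<omega>. ennreal (e \<omega>))"
  have EF [measurable]: "E \<in> borel_measurable F" and EM [measurable]: "E \<in> borel_measurable M"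
    by (simp_all add: E_def)
  have [measurable]: "\<sigma> \<in> borel_measurable F"
    unfolding \<sigma> by measurable
  \<comment> \<open>\<open>w\<close> collects the factors known from the past, so only
    \<open>exp (- \<theta> * Z)\<close> is left to control; \<open>q\<close> is the past-measurable
    part of its quadratic bound.\<close>
  define w where "w \<omega> = Y \<omega> * exp (\<theta> * (a \<omega> / 2 - c * \<sigma> \<omega>))" for \<omega>
  define q where "q \<omega> = 1 - \<theta> * a \<omega> + (\<theta> * a \<omega>)\<^sup>2" for \<omega>
  have wF [measurable]: "w \<in> borel_measurable F" and qF [measurable]: "q \<in> borel_measurable F"
    unfolding w_def q_def by measurable
  have [measurable]: "w \<in> borel_measurable M" "q \<in> borel_measurable M"
    using measurable_from_subalg[OF subalg] wF qF by blast+
  have w0: "0 \<le> w \<omega>" and q0: "0 \<le> q \<omega>" if "\<omega> \<in> space M" for \<omega>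
    using that Y a[OF that] by (auto simp: w_def q_def)
  have "(\<integral>\<^sup>+\<omega>. ennreal (Y \<omega> * exp (\<theta> * (a \<omega> / 2 - c * \<sigma> \<omega> - Z \<omega>))) \<partial>M)
      \<le> (\<integral>\<^sup>+\<omega>. ennreal (w \<omega> * q \<omega>) + ennreal (w \<omega> * (\<theta> * c)) * ennreal (e \<omega>) \<partial>M)"
  proof (rule nn_integral_mono)
    fix \<omega> assume \<omega>: "\<omega> \<in> space M"
    have "exp (- (\<theta> * Z \<omega>)) \<le> 1 - \<theta> * Z \<omega> + (\<theta> * a \<omega>)\<^sup>2"
      using a[OF \<omega>] Za[OF \<omega>] \<theta>
      by (intro exp_minus_le_quadratic) (auto simp: abs_mult mult_left_mono)
    \<comment> \<open>Only the linear term still contains \<open>Z\<close>; replacing it by the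
      lower bound \<open>a - c * e\<close> leaves \<open>e\<close> as the sole quantity not known
      from the past, and it enters linearly.\<close>
    also have "\<dots> \<le> q \<omega> + \<theta> * c * e \<omega>"
      using mult_left_mono[OF Ze[OF \<omega>] \<theta>] by (simp add: q_def algebra_simps)
    finally have "w \<omega> * exp (- (\<theta> * Z \<omega>)) \<le> w \<omega> * (q \<omega> + \<theta> * c * e \<omega>)"
      using w0[OF \<omega>] by (rule mult_left_mono)
    moreover have "\<theta> * (a \<omega> / 2 - c * \<sigma> \<omega> - Z \<omega>) = \<theta> * (a \<omega> / 2 - c * \<sigma> \<omega>) + - (\<theta> * Z \<omega>)"
      by (simp add: right_diff_distrib)
    then have "Y \<omega> * exp (\<theta> * (a \<omega> / 2 - c * \<sigma> \<omega> - Z \<omega>)) = w \<omega> * exp (- (\<theta> * Z \<omega>))"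
      by (simp only: w_def exp_add mult.assoc)
    moreover have "ennreal (w \<omega> * q \<omega>) + ennreal (w \<omega> * (\<theta> * c)) * ennreal (e \<omega>)
        = ennreal (w \<omega> * (q \<omega> + \<theta> * c * e \<omega>))"
      using w0[OF \<omega>] q0[OF \<omega>] e[OF \<omega>] c \<theta>
      by (simp add: distrib_left mult.assoc flip: ennreal_plus ennreal_mult)
    ultimately show "ennreal (Y \<omega> * exp (\<theta> * (a \<omega> / 2 - c * \<sigma> \<omega> - Z \<omega>)))
        \<le> ennreal (w \<omega> * q \<omega>) + ennreal (w \<omega> * (\<theta> * c)) * ennreal (e \<omega>)"
      by (simp add: ennreal_leI)
  qed
  also have "\<dots> = (\<integral>\<^sup>+\<omega>. ennreal (w \<omega> * q \<omega>) \<partial>M)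
      + (\<integral>\<^sup>+\<omega>. ennreal (w \<omega> * (\<theta> * c)) * ennreal (e \<omega>) \<partial>M)"
    by (rule nn_integral_add) measurable
  also have "(\<integral>\<^sup>+\<omega>. ennreal (w \<omega> * (\<theta> * c)) * ennreal (e \<omega>) \<partial>M)
      = (\<integral>\<^sup>+\<omega>. ennreal (w \<omega> * (\<theta> * c)) * E \<omega> \<partial>M)"
    unfolding E_def by (rule nn_cond_exp_intg[symmetric]) measurable
  also have "(\<integral>\<^sup>+\<omega>. ennreal (w \<omega> * q \<omega>) \<partial>M) + \<dots>
      = (\<integral>\<^sup>+\<omega>. ennreal (w \<omega> * q \<omega>) + ennreal (w \<omega> * (\<theta> * c)) * E \<omega> \<partial>M)"
    by (rule nn_integral_add[symmetric]) measurable
  also have "\<dots> \<le> (\<integral>\<^sup>+\<omega>. ennreal (Y \<omega>) \<partial>M)"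
  proof (rule nn_integral_mono_AE)
    show "AE \<omega> in M. ennreal (w \<omega> * q \<omega>) + ennreal (w \<omega> * (\<theta> * c)) * E \<omega> \<le> ennreal (Y \<omega>)"
      using fin AE_space
    proof eventually_elim
      case (elim \<omega>)
      then have E: "E \<omega> = ennreal (\<sigma> \<omega>)" and \<sigma>0: "0 \<le> \<sigma> \<omega>"
        by (simp_all add: \<sigma> E_def)
      have "0 \<le> a \<omega>"
        using Za[of \<omega>] elim by linarith
      \<comment> \<open>Since \<open>\<theta> * a \<le> 1 / 2\<close>, the square costs at most half
        of the linear term; this is the origin of \<open>a / 2\<close> in the exponent.\<close>
      then have "(\<theta> * a \<omega>) * (\<theta> * a \<omega>) \<le> (\<theta> * a \<omega>) * (1 / 2)"
        using a[of \<omega>] elim \<theta> by (intro mult_left_mono) auto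
      then have "q \<omega> + \<theta> * c * \<sigma> \<omega> \<le> 1 + - (\<theta> * (a \<omega> / 2 - c * \<sigma> \<omega>))"
        by (simp add: q_def power2_eq_square algebra_simps)
      also have "\<dots> \<le> exp (- (\<theta> * (a \<omega> / 2 - c * \<sigma> \<omega>)))"
        by (rule exp_ge_add_one_self)
      finally have "w \<omega> * (q \<omega> + \<theta> * c * \<sigma> \<omega>) \<le> w \<omega> * exp (- (\<theta> * (a \<omega> / 2 - c * \<sigma> \<omega>)))"
        using w0[of \<omega>] elim by (intro mult_left_mono) auto
      also have "\<dots> = Y \<omega>"
        by (simp add: w_def exp_minus)
      finally have "ennreal (w \<omega> * (q \<omega> + \<theta> * c * \<sigma> \<omega>)) \<le> ennreal (Y \<omega>)"
        by (rule ennreal_leI)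
      moreover have "ennreal (w \<omega> * q \<omega>) + ennreal (w \<omega> * (\<theta> * c)) * E \<omega>
          = ennreal (w \<omega> * (q \<omega> + \<theta> * c * \<sigma> \<omega>))"
        using w0[of \<omega>] q0[of \<omega>] elim c \<theta> \<sigma>0
        by (simp add: E distrib_left mult.assoc flip: ennreal_plus ennreal_mult)
      ultimately show ?case by simp
    qed
  qed
  finally show ?thesis .
qed

end

subsection \<open>The history of the gradient estimators\<close>

lemma space_hist [simp]: "space (hist M g n) = space M"
  by (simp add: hist_def space_measure_of_conv)

lemma sets_hist:
  "sets (hist M g n)
    = sigma_sets (space M) {g s -` B \<inter> space M | s B. s \<in> {1..n} \<and> B \<in> sets borel}"
  unfolding hist_def by (rule sets_measure_of) auto

lemma subalgebra_hist:
  assumes "\<And>t. t \<ge> 1 \<Longrightarrow> g t \<in> borel_measurable M"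
  shows "subalgebra M (hist M g n)"
  unfolding subalgebra_def sets_hist
  using assms by (auto intro!: sets.sigma_sets_subset measurable_sets)

lemma subalgebra_hist_mono: "m \<le> n \<Longrightarrow> subalgebra (hist M g n) (hist M g m)"
  unfolding subalgebra_def sets_hist by (force intro!: sigma_sets_mono')

lemma measurable_hist:
  assumes "1 \<le> s" "s \<le> n"
  shows "g s \<in> borel_measurable (hist M g n)"
  by (rule measurableI) (use assms in \<open>auto simp: sets_hist intro!: sigma_sets.Basic\<close>)

text \<open>Start and stepsizes are deterministic, so \<open>x (Suc n)\<close> is a function of the
  first \<open>n\<close> estimators. The index shift makes the gradient at each step known before
  that step's estimator is drawn.\<close>

lemma measurable_nsgd_hist:
  fixes g x :: "nat \<Rightarrow> 'a \<Rightarrow> 'v::euclidean_space"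
  assumes "nsgd M x1 \<eta> g x"
  shows "x (Suc n) \<in> borel_measurable (hist M g n)"
proof (induction n)
  case 0
  have "x 1 \<omega> = x1" if "\<omega> \<in> space (hist M g 0)" for \<omega>
    using assms that by (simp add: nsgd_def)
  then show ?case
    by (subst measurable_cong[where g = "\<lambda>_. x1"]) auto
next
  case (Suc n)
  have [measurable]: "g (Suc n) \<in> borel_measurable (hist M g (Suc n))"
    by (rule measurable_hist) auto
  have [measurable]: "x (Suc n) \<in> borel_measurable (hist M g (Suc n))"
    using measurable_from_subalg[OF subalgebra_hist_mono Suc] by simp
  have "x (Suc (Suc n)) \<omega> = x (Suc n) \<omega> - \<eta> (Suc n) *\<^sub>R (g (Suc n) \<omega> /\<^sub>R norm (g (Suc n) \<omega>))"
    if "\<omega> \<in> space (hist M g (Suc n))" for \<omega>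
    using assms that by (simp add: nsgd_def)
  then show ?case
    by (subst measurable_cong) auto
qed

subsection \<open>NSGD iterates\<close>

lemma norm_normalized_le: "norm (w /\<^sub>R norm w) \<le> 1"
  for w :: "'v::real_normed_vector"
  by (cases "w = 0") auto

text \<open>Normalization limits each move to length \<open>\<eta> n\<close>, whatever the estimator
  is. The total distance from \<open>x1\<close> is thus bounded deterministically, and the Lipschitz
  property carries this over to gradients.\<close>

lemma nsgd_norm_gradient_le:
  fixes g x :: "nat \<Rightarrow> 'a \<Rightarrow> 'v::euclidean_space"
  assumes "nsgd M x1 \<eta> g x" "L_smooth L F" "\<And>t. t \<ge> 1 \<Longrightarrow> \<eta> t > 0" "\<omega> \<in> space M" "1 \<le> t"
  shows "norm (gradient F (x t \<omega>)) \<le> norm (gradient F x1) + L * (\<Sum>\<tau>\<in>{1..<t}. \<eta> \<tau>)"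
proof -
  have "norm (x t \<omega> - x1) \<le> (\<Sum>\<tau>\<in>{1..<t}. \<eta> \<tau>)"
    using \<open>1 \<le> t\<close>
  proof (induction t rule: dec_induct)
    case base
    then show ?case using assms by (simp add: nsgd_def)
  next
    case (step n)
    define u where "u = g n \<omega> /\<^sub>R norm (g n \<omega>)"
    have "x (Suc n) \<omega> - x1 = (x n \<omega> - x1) - \<eta> n *\<^sub>R u"
      using assms step by (simp add: nsgd_def u_def)
    then have "norm (x (Suc n) \<omega> - x1) \<le> norm (x n \<omega> - x1) + norm (\<eta> n *\<^sub>R u)"
      by (simp only: norm_triangle_ineq4)
    also have "norm (\<eta> n *\<^sub>R u) \<le> \<eta> n * 1"
      using assms(3)[of n] step norm_normalized_le[of "g n \<omega>"]
      unfolding norm_scaleR u_def[symmetric] by (intro mult_mono) auto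
    finally show ?case
      using step by simp
  qed
  then have "L * norm (x t \<omega> - x1) \<le> L * (\<Sum>\<tau>\<in>{1..<t}. \<eta> \<tau>)"
    using assms by (intro mult_left_mono) (auto simp: L_smooth_def)
  moreover have "norm (gradient F (x t \<omega>) - gradient F x1) \<le> L * norm (x t \<omega> - x1)"
    using assms by (simp add: L_smooth_def)
  moreover have "norm (gradient F (x t \<omega>))
      \<le> norm (gradient F x1) + norm (gradient F (x t \<omega>) - gradient F x1)"
    by (rule norm_triangle_sub)
  ultimately show ?thesis by linarith
qed

text \<open>The descent inequality is summed along the path: function values telescope, and each
  quadratic term is at most \<open>L / 2 * (\<eta> t)^2\<close> because the direction has norm at
  most 1, also when the estimator vanishes.\<close>

lemma nsgd_descent:
  fixes g x :: "nat \<Rightarrow> 'a \<Rightarrow> 'v::euclidean_space"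
  assumes "nsgd M x1 \<eta> g x" "L_smooth L F" "\<omega> \<in> space M"
  shows "(\<Sum>t=1..n. \<eta> t * inner (gradient F (x t \<omega>)) (g t \<omega> /\<^sub>R norm (g t \<omega>)))
      \<le> F x1 - F (x (Suc n) \<omega>) + L / 2 * (\<Sum>t=1..n. (\<eta> t)\<^sup>2)"
proof (induction n)
  case 0
  show ?case using assms by (simp add: nsgd_def)
next
  case (Suc n)
  define u where "u = g (Suc n) \<omega> /\<^sub>R norm (g (Suc n) \<omega>)"
  have step: "x (Suc (Suc n)) \<omega> - x (Suc n) \<omega> = - (\<eta> (Suc n) *\<^sub>R u)"
    using assms by (simp add: nsgd_def u_def)
  have "L / 2 * (norm (\<eta> (Suc n) *\<^sub>R u))\<^sup>2 = (L / 2 * (\<eta> (Suc n))\<^sup>2) * (norm u)\<^sup>2"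
    by (simp add: power_mult_distrib)
  also have "\<dots> \<le> (L / 2 * (\<eta> (Suc n))\<^sup>2) * 1"
    using assms norm_normalized_le[of "g (Suc n) \<omega>"]
    by (intro mult_left_mono) (auto simp: L_smooth_def power_le_one u_def[symmetric])
  finally have "F (x (Suc (Suc n)) \<omega>) \<le> F (x (Suc n) \<omega>)
      - \<eta> (Suc n) * inner (gradient F (x (Suc n) \<omega>)) u + L / 2 * (\<eta> (Suc n))\<^sup>2"
    using L_smooth_descent[OF assms(2), of "x (Suc (Suc n)) \<omega>" "x (Suc n) \<omega>"]
    unfolding step by simp
  with Suc show ?case
    by (simp add: distrib_left flip: u_def del: inner_scaleR_right)
qed

section \<open>The exponential supermartingale\<close>

text \<open>Induction on \<open>n\<close>, one conditional step at a time. Measurability of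
  \<open>S n\<close> with respect to the history belongs to the induction claim because
  \<open>exp (\<theta> * S n)\<close> serves as the past-measurable weight in the next step.\<close>

lemma nsgd_nn_integral_exp_le:
  fixes g x :: "nat \<Rightarrow> 'a \<Rightarrow> 'v::euclidean_space"
  assumes "prob_space M" "L_smooth L F" "nsgd M x1 \<eta> g x"
    and \<eta>: "\<And>t. t \<ge> 1 \<Longrightarrow> \<eta> t > 0"
    and g: "\<And>t. t \<ge> 1 \<Longrightarrow> g t \<in> borel_measurable M"
    and fin: "\<And>t. t \<ge> 1 \<Longrightarrow> AE \<omega> in M. cond_error M F g x t \<omega> < \<infinity>"
    and \<theta>: "0 \<le> \<theta>"
    and le: "\<And>t \<omega>. t \<in> {1..T} \<Longrightarrow> \<omega> \<in> space M \<Longrightarrow> \<theta> * (\<eta> t * norm (gradient F (x t \<omega>))) \<le> 1 / 2"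
    and "n \<le> T"
  defines "S \<equiv> \<lambda>n \<omega>. \<Sum>t=1..n. \<eta> t * norm (gradient F (x t \<omega>)) / 2
      - (2 * \<eta> t) * enn2real (cond_error M F g x t \<omega>)
      - \<eta> t * inner (gradient F (x t \<omega>)) (g t \<omega> /\<^sub>R norm (g t \<omega>))"
  shows "S n \<in> borel_measurable (hist M g n) \<and> (\<integral>\<^sup>+\<omega>. ennreal (exp (\<theta> * S n \<omega>)) \<partial>M) \<le> 1"
  using \<open>n \<le> T\<close>
proof (induction n)
  case 0
  have "emeasure M (space M) = 1"
    using assms(1) by (rule prob_space.emeasure_space_1)
  then show ?case by (simp add: S_def)
next
  case (Suc n)
  let ?t = "Suc n"
  interpret prob_space M by fact
  interpret finite_measure_subalgebra M "hist M g n"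
    by unfold_locales (use subalgebra_hist[OF g] in auto)
  have [measurable]: "gradient F \<in> borel_measurable borel"
    using L_smooth_continuous_gradient[OF assms(2)] by (rule borel_measurable_continuous_onI)
  note sub = measurable_from_subalg[OF subalgebra_hist_mono[of n ?t]]
  have xn: "x ?t \<in> borel_measurable (hist M g n)"
    using measurable_nsgd_hist[OF assms(3)] .
  have [measurable]: "g ?t \<in> borel_measurable (hist M g ?t)" "x ?t \<in> borel_measurable (hist M g ?t)"
      "g ?t \<in> borel_measurable M" "x ?t \<in> borel_measurable M"
    using measurable_hist[of ?t ?t g M] sub[OF _ xn] g[of ?t] measurable_from_subalg[OF subalg xn]
    by auto
  have Sn: "S n \<in> borel_measurable (hist M g n)" and IH: "(\<integral>\<^sup>+\<omega>. ennreal (exp (\<theta> * S n \<omega>)) \<partial>M) \<le> 1"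
    using Suc by auto
  \<comment> \<open>Since \<open>Suc n - 1 = n\<close>, the error of step \<open>Suc n\<close> is
    conditioned on exactly the first \<open>n\<close> estimators.\<close>
  have c: "cond_error M F g x ?t \<in> borel_measurable (hist M g n)"
    by (simp add: cond_error_def)
  have [measurable]: "S n \<in> borel_measurable (hist M g ?t)"
      "cond_error M F g x ?t \<in> borel_measurable (hist M g ?t)"
    using sub[OF _ Sn] sub[OF _ c] by auto
  define a where "a \<omega> = \<eta> ?t * norm (gradient F (x ?t \<omega>))" for \<omega>
  define Z where "Z \<omega> = \<eta> ?t * inner (gradient F (x ?t \<omega>)) (g ?t \<omega> /\<^sub>R norm (g ?t \<omega>))" for \<omega>
  define e where "e \<omega> = norm (g ?t \<omega> - gradient F (x ?t \<omega>))" for \<omega>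
  define \<sigma> where "\<sigma> \<omega> = enn2real (cond_error M F g x ?t \<omega>)" for \<omega>
  have S: "S ?t = (\<lambda>\<omega>. S n \<omega> + (a \<omega> / 2 - (2 * \<eta> ?t) * \<sigma> \<omega> - Z \<omega>))"
    by (simp add: S_def a_def Z_def \<sigma>_def fun_eq_iff)
  have "S ?t \<in> borel_measurable (hist M g ?t)"
    unfolding S a_def Z_def \<sigma>_def by measurable
  moreover have "(\<integral>\<^sup>+\<omega>. ennreal (exp (\<theta> * S ?t \<omega>)) \<partial>M) \<le> 1"
  proof -
    have "(\<integral>\<^sup>+\<omega>. ennreal (exp (\<theta> * S ?t \<omega>)) \<partial>M)
        = (\<integral>\<^sup>+\<omega>. ennreal (exp (\<theta> * S n \<omega>) * exp (\<theta> * (a \<omega> / 2 - (2 * \<eta> ?t) * \<sigma> \<omega> - Z \<omega>))) \<partial>M)"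
      unfolding S by (simp add: distrib_left exp_add)
    also have "\<dots> \<le> (\<integral>\<^sup>+\<omega>. ennreal (exp (\<theta> * S n \<omega>)) \<partial>M)"
    proof (rule nn_integral_exp_step[where e = e])
      show "(\<lambda>\<omega>. exp (\<theta> * S n \<omega>)) \<in> borel_measurable (hist M g n)"
        using Sn by measurable
      show "a \<in> borel_measurable (hist M g n)"
        unfolding a_def using xn by measurable
      show "Z \<in> borel_measurable M" "e \<in> borel_measurable M"
        unfolding Z_def e_def by measurable
      show "0 \<le> 2 * \<eta> ?t"
        using \<eta>[of ?t] by simp
      show "AE \<omega> in M. nn_cond_exp M (hist M g n) (\<lambda>\<omega>. ennreal (e \<omega>)) \<omega> < \<infinity>"
        using fin[of ?t] by (simp add: cond_error_def e_def)
      show "\<sigma> = (\<lambda>\<omega>. enn2real (nn_cond_exp M (hist M g n) (\<lambda>\<omega>. ennreal (e \<omega>)) \<omega>))"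
        by (simp add: \<sigma>_def cond_error_def e_def fun_eq_iff)
      fix \<omega> assume \<omega>: "\<omega> \<in> space M"
      show "\<theta> * a \<omega> \<le> 1 / 2"
        unfolding a_def using le \<omega> Suc.prems by simp
      have "\<bar>inner (gradient F (x ?t \<omega>)) (g ?t \<omega> /\<^sub>R norm (g ?t \<omega>))\<bar>
          \<le> norm (gradient F (x ?t \<omega>)) * norm (g ?t \<omega> /\<^sub>R norm (g ?t \<omega>))"
        by (rule Cauchy_Schwarz_ineq2)
      also have "\<dots> \<le> norm (gradient F (x ?t \<omega>)) * 1"
        by (intro mult_left_mono norm_normalized_le) auto
      finally show "\<bar>Z \<omega>\<bar> \<le> a \<omega>"
        unfolding Z_def a_def using \<eta>[of ?t] by (simp add: abs_mult)
      show "a \<omega> - 2 * \<eta> ?t * e \<omega> \<le> Z \<omega>"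
        using mult_left_mono[OF inner_normalized_ge[of "gradient F (x ?t \<omega>)" "g ?t \<omega>"], of "\<eta> ?t"]
          \<eta>[of ?t]
        unfolding Z_def a_def e_def by (simp add: algebra_simps)
    qed (use \<theta> in \<open>auto simp: e_def\<close>)
    finally show ?thesis
      using IH by (rule order_trans)
  qed
  ultimately show ?case ..
qed

section \<open>The high-probability bound\<close>

theorem theorem4:
  fixes M :: "'a measure"
    and F :: "real ^ 'd \<Rightarrow> real"
    and x1 :: "real ^ 'd"
    and g x :: "nat \<Rightarrow> 'a \<Rightarrow> real ^ 'd"
    and \<eta> :: "nat \<Rightarrow> real"
    and Fstar \<Delta>1 L \<delta> :: real
    and T :: nat
  assumes "prob_space M"
    and "0 < \<delta>" and "\<delta> < 1"
    and "\<And>y. Fstar \<le> F y"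
    and "F x1 - Fstar \<le> \<Delta>1"
    and "L_smooth L F"
    and "\<And>t. t \<ge> 1 \<Longrightarrow> \<eta> t > 0"
    and "\<And>t. t \<ge> 1 \<Longrightarrow> g t \<in> borel_measurable M"
    and "nsgd M x1 \<eta> g x"
    and "\<And>t. t \<ge> 1 \<Longrightarrow> AE \<omega> in M. cond_error M F g x t \<omega> < \<infinity>"
    and "T \<ge> 1"
  defines "\<eta>max \<equiv> Max (\<eta> ` {1..T})"
    and "C \<equiv> Max ((\<lambda>t. \<eta> t * (\<Sum>\<tau>\<in>{1..<t}. \<eta> \<tau>)) ` {1..T})"
    and "\<sigma> \<equiv> \<lambda>t \<omega>. enn2real (cond_error M F g x t \<omega>)"
  shows "measure M {\<omega> \<in> space M.
      (\<Sum>t=1..T. \<eta> t / (\<Sum>\<tau>=1..T. \<eta> \<tau>) * norm (gradient F (x t \<omega>)))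
      \<le> (2 * \<Delta>1 + L * (\<Sum>t=1..T. (\<eta> t)\<^sup>2) + 4 * (\<Sum>t=1..T. \<eta> t * \<sigma> t \<omega>))
            / (\<Sum>\<tau>=1..T. \<eta> \<tau>)
        + 12 * (\<eta>max * norm (gradient F x1) + C * L) * ln (1 / \<delta>)
            / (\<Sum>\<tau>=1..T. \<eta> \<tau>)} \<ge> 1 - \<delta>"
    (is "measure M ?good \<ge> _")
proof -
  interpret prob_space M by fact
  note \<eta> = assms(7)
  note smooth = assms(6)
  have sub: "subalgebra M (hist M g n)" for n
    using assms(8) by (rule subalgebra_hist)
  define K where "K = \<eta>max * norm (gradient F x1) + C * L"
  define A where "A \<omega> = (\<Sum>t=1..T. \<eta> t * norm (gradient F (x t \<omega>)))" for \<omega>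
  define B where "B \<omega> = (\<Sum>t=1..T. \<eta> t * \<sigma> t \<omega>)" for \<omega>
  define Q where "Q = (\<Sum>t=1..T. (\<eta> t)\<^sup>2)"
  define l where "l = ln (1 / \<delta>)"
  have H: "0 < (\<Sum>\<tau>=1..T. \<eta> \<tau>)"
    using \<eta> \<open>T \<ge> 1\<close> by (intro sum_pos) auto
  have L: "0 \<le> L" using smooth by (simp add: L_smooth_def)
  have l: "0 < l" unfolding l_def using assms(2,3) by (simp add: ln_gt_zero)
  \<comment> \<open>The common positive denominator is cleared once, so that the rest concerns
    unnormalized sums.\<close>
  have good: "?good = {\<omega> \<in> space M. A \<omega> \<le> 2 * \<Delta>1 + L * Q + 4 * B \<omega> + 12 * K * l}"
  proof -
    have "(\<Sum>t=1..T. \<eta> t / (\<Sum>\<tau>=1..T. \<eta> \<tau>) * norm (gradient F (x t \<omega>)))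
        = A \<omega> / (\<Sum>\<tau>=1..T. \<eta> \<tau>)" for \<omega>
      unfolding A_def sum_divide_distrib by simp
    then show ?thesis
      using H by (simp add: A_def B_def Q_def l_def K_def divide_le_cancel flip: add_divide_distrib)
  qed
  \<comment> \<open>Maximizing the two terms of the deterministic gradient bound separately over
    \<open>t\<close> gives \<open>K\<close>.\<close>
  have bound: "\<eta> t * norm (gradient F (x t \<omega>)) \<le> K" if t: "t \<in> {1..T}" and \<omega>: "\<omega> \<in> space M" for t \<omega>
  proof -
    have "\<eta> t * norm (gradient F (x t \<omega>))
        \<le> \<eta> t * (norm (gradient F x1) + L * (\<Sum>\<tau>\<in>{1..<t}. \<eta> \<tau>))"
      using t \<omega> \<eta>[of t] by (intro mult_left_mono nsgd_norm_gradient_le[OF assms(9) smooth \<eta>]) auto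
    also have "\<dots> = \<eta> t * norm (gradient F x1) + (\<eta> t * (\<Sum>\<tau>\<in>{1..<t}. \<eta> \<tau>)) * L"
      by (simp add: algebra_simps)
    also have "\<dots> \<le> K"
      unfolding K_def \<eta>max_def C_def
      using t L by (intro add_mono mult_right_mono Max_ge) auto
    finally show ?thesis .
  qed
  have B0: "0 \<le> B \<omega>" for \<omega>
    unfolding B_def \<sigma>_def using \<eta> by (intro sum_nonneg mult_nonneg_nonneg) (auto intro: less_imp_le)
  have \<Delta>0: "0 \<le> \<Delta>1"
    using assms(4)[of x1] assms(5) by linarith
  have Q0: "0 \<le> L * Q"
    unfolding Q_def using L by (intro mult_nonneg_nonneg sum_nonneg) auto
  show ?thesis
  \<comment> \<open>The choice \<open>\<theta> = 1 / (2 * K)\<close> requires \<open>K > 0\<close>.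
    Otherwise \<open>K = 0\<close>, the left side \<open>A\<close> is at most 0 everywhere, and the
    inequality holds surely.\<close>
  proof (cases "K \<le> 0")
    case True
    obtain \<omega>0 where "\<omega>0 \<in> space M"
      using not_empty by blast
    moreover have "0 \<le> \<eta> 1 * norm (gradient F (x 1 \<omega>0))"
      using \<eta>[of 1] by simp
    ultimately have K: "K = 0"
      using True bound[of 1 \<omega>0] \<open>T \<ge> 1\<close> by simp
    have "A \<omega> \<le> 0" if "\<omega> \<in> space M" for \<omega>
      unfolding A_def using bound that K by (intro sum_nonpos) auto
    then have "?good = space M"
      unfolding good using B0 \<Delta>0 Q0 K by (force intro: order_trans[OF _ add_nonneg_nonneg])
    then show ?thesis
      using assms(2) prob_space by simp
  next
    case False
    then have K: "0 < K" by simp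
    define Z where "Z \<omega> = (\<Sum>t=1..T. \<eta> t * inner (gradient F (x t \<omega>)) (g t \<omega> /\<^sub>R norm (g t \<omega>)))" for \<omega>
    define S where "S \<omega> = A \<omega> / 2 - 2 * B \<omega> - Z \<omega>" for \<omega>
    \<comment> \<open>The largest \<open>\<theta>\<close> for which \<open>bound\<close> guarantees
      \<open>\<theta> * (\<eta> t * norm (gradient F (x t \<omega>))) \<le> 1 / 2\<close>.\<close>
    define \<theta> where "\<theta> = 1 / (2 * K)"
    have S_eq: "S \<omega> = (\<Sum>t=1..T. \<eta> t * norm (gradient F (x t \<omega>)) / 2
        - (2 * \<eta> t) * enn2real (cond_error M F g x t \<omega>)
        - \<eta> t * inner (gradient F (x t \<omega>)) (g t \<omega> /\<^sub>R norm (g t \<omega>)))" for \<omega>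
      by (simp add: S_def A_def B_def Z_def \<sigma>_def sum_subtractf sum_divide_distrib
          sum_distrib_left mult.assoc)
    have S: "S \<in> borel_measurable (hist M g T) \<and> (\<integral>\<^sup>+\<omega>. ennreal (exp (\<theta> * S \<omega>)) \<partial>M) \<le> 1"
      unfolding S_eq[abs_def]
      by (rule nsgd_nn_integral_exp_le[OF assms(1) smooth assms(9) \<eta> assms(8) assms(10), where T = T])
        (use bound K in \<open>auto simp: \<theta>_def field_simps\<close>)
    have [measurable]: "S \<in> borel_measurable M"
      using S measurable_from_subalg[OF sub] by blast
    have \<theta>: "0 < \<theta>" using K by (simp add: \<theta>_def)
    \<comment> \<open>The threshold \<open>l / \<theta>\<close> is chosen so that the Chernoff
      factor \<open>exp (- l)\<close> equals \<open>\<delta>\<close>.\<close>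
    have "emeasure M {\<omega> \<in> space M. S \<omega> \<ge> l / \<theta>}
        \<le> ennreal (exp (- \<theta> * (l / \<theta>))) * (\<integral>\<^sup>+\<omega>. ennreal (exp (\<theta> * S \<omega>)) * indicator (space M) \<omega> \<partial>M)"
      by (rule Chernoff_ineq_nn_integral_ge) (use \<theta> in auto)
    also have "(\<integral>\<^sup>+\<omega>. ennreal (exp (\<theta> * S \<omega>)) * indicator (space M) \<omega> \<partial>M)
        = (\<integral>\<^sup>+\<omega>. ennreal (exp (\<theta> * S \<omega>)) \<partial>M)"
      by (intro nn_integral_cong) auto
    also have "ennreal (exp (- \<theta> * (l / \<theta>))) * \<dots> \<le> ennreal (exp (- \<theta> * (l / \<theta>))) * 1"
      using S by (intro mult_left_mono) auto
    also have "\<dots> = ennreal \<delta>"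
      using \<theta> assms(2) by (simp add: l_def ln_div)
    finally have "measure M {\<omega> \<in> space M. S \<omega> \<ge> l / \<theta>} \<le> \<delta>"
      using assms(2) by (simp add: emeasure_eq_measure)
    moreover have "measure M {\<omega> \<in> space M. \<not> S \<omega> \<ge> l / \<theta>}
        = 1 - measure M {\<omega> \<in> space M. S \<omega> \<ge> l / \<theta>}"
      by (rule prob_neg) measurable
    ultimately have "1 - \<delta> \<le> measure M {\<omega> \<in> space M. \<not> S \<omega> \<ge> l / \<theta>}"
      by simp
    also have "\<dots> \<le> measure M ?good"
    proof (rule finite_measure_mono)
      show "{\<omega> \<in> space M. \<not> S \<omega> \<ge> l / \<theta>} \<subseteq> ?good"
        unfolding good
      proof (intro subsetI, elim CollectE conjE, intro CollectI conjI)
        \<comment> \<open>Here \<open>l / \<theta> = 2 * K * l\<close>. Doubling the inequality and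
          inserting the descent bound on \<open>Z\<close> gives the claim with
          \<open>4 * K * l\<close>, which is weakened to \<open>12 * K * l\<close>.\<close>
        fix \<omega> assume \<omega>: "\<omega> \<in> space M" and "\<not> l / \<theta> \<le> S \<omega>"
        then have "A \<omega> / 2 - 2 * B \<omega> - Z \<omega> \<le> 2 * (K * l)"
          by (simp add: S_def \<theta>_def mult_ac)
        moreover have "Z \<omega> \<le> \<Delta>1 + L / 2 * Q"
          using nsgd_descent[OF assms(9) smooth \<omega>, of T] assms(4)[of "x (Suc T) \<omega>"] assms(5)
          unfolding Z_def Q_def by linarith
        moreover have "0 \<le> K * l" using K l by simp
        ultimately show "A \<omega> \<le> 2 * \<Delta>1 + L * Q + 4 * B \<omega> + 12 * K * l"
          by (simp add: field_simps)
      qed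
      \<comment> \<open>Monotonicity of the measure needs the larger event to be measurable.\<close>
      have "A \<in> borel_measurable M" "B \<in> borel_measurable M"
      proof -
        have [measurable]: "gradient F \<in> borel_measurable borel"
          using L_smooth_continuous_gradient[OF smooth] by (rule borel_measurable_continuous_onI)
        have "x t \<in> borel_measurable M" if "t \<in> {1..T}" for t
          using measurable_from_subalg[OF sub measurable_nsgd_hist[OF assms(9), of "t - 1"]] that
          by simp
        then show "A \<in> borel_measurable M"
          unfolding A_def by measurable
        show "B \<in> borel_measurable M"
          unfolding B_def \<sigma>_def cond_error_def by measurable
      qed
      then show "?good \<in> sets M"
        unfolding good by measurable
    qed
    finally show ?thesis .
  qed
qed

end
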